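(* Let $d\ge1$ be a fixed integer. For integers $m\ge 2$ let $\boldsymbol{\Omega}=\{\Omega_{\boldsymbol{i}}:\boldsymbol{i}\in\mathbb{N}_m^d\}$ be the jittered partition of $[0,1]^d$ into $N=m^d$ cubes, with associated jittered point set $\mathcal{P}_{\boldsymbol{\Omega}}$. Then $$\mathbb{E}\,\mathcal{L}_2(\mathcal{P}_{\boldsymbol{\Omega}})=\Theta\left(\frac{1}{m^{\frac d2+\frac12}}\right)=\Theta\left(\frac{1}{N^{\frac12+\frac1{2d}}}\right),$$ i.e. there are constants $0<c_d\le C_d$ depending only on $d$ such that $c_d\,N^{-\frac12-\frac1{2d}}\le\mathbb{E}\,\mathcal{L}_2(\mathcal{P}_{\boldsymbol{\Omega}})\le C_d\,N^{-\frac12-\frac1{2d}}$ for all $m\ge2$.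
   Context: $\mathbb{N}_m^d$ is the set of $d$-tuples $\boldsymbol{i}=(i_1,\dots,i_d)$ with entries in $\{1,\dots,m\}$. The jittered partition of $[0,1]^d$ consists of the $m^d$ axis-aligned cubes $\Omega_{\boldsymbol{i}}=\prod_{j=1}^d\left[\frac{i_j-1}{m},\frac{i_j}{m}\right]$, $\boldsymbol{i}\in\mathbb{N}_m^d$, of equal volume $m^{-d}$ (they overlap only on boundaries). The jittered point set $\mathcal{P}_{\boldsymbol{\Omega}}$ consists of $N=m^d$ independent random points, one uniformly distributed in each $\Omega_{\boldsymbol{i}}$. For a point set $\mathcal{P}=\{\mathbf{x}_1,\dots,\mathbf{x}_N\}\subset[0,1]^d$, the $\mathcal{L}_2$-discrepancy is $$\mathcal{L}_2(\mathcal{P})=\left(\int_{[0,1]^d}\left|\frac{\#(\mathcal{P}\cap[0,\mathbf{x}))}{N}-|[0,\mathbf{x})|\right|^2d\mathbf{x}\right)^{1/2},$$ where $[0,\mathbf{x})=\prod_{j=1}^d[0,x_j)$, $|\cdot|$ of a set is Lebesgue measure, and $\#(\mathcal{P}\cap[0,\mathbf{x}))$ is the number of indices $k\in\{1,\dots,N\}$ with $\mathbf{x}_k\in[0,\mathbf{x})$. *)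

theory Defs
  imports "HOL-Probability.Probability" "HOL-Library.Landau_Symbols"
begin

definition anchored_box :: "real ^ 'd \<Rightarrow> (real ^ 'd) set" where
  "anchored_box x = {y. \<forall>j. 0 \<le> y $ j \<and> y $ j < x $ j}"

text \<open>A point set is a finite family \<open>p\<close> of points with index set \<open>I\<close>; points are counted by
  index, that is, with multiplicity.\<close>

definition L2_discrepancy :: "'i set \<Rightarrow> ('i \<Rightarrow> real ^ 'd) \<Rightarrow> real" where
  "L2_discrepancy I p =
     sqrt (LINT x:cbox 0 1|lborel.
       \<bar>real (card {k \<in> I. p k \<in> anchored_box x}) / real (card I)
         - measure lborel (anchored_box x)\<bar>\<^sup>2)"

definition multi_indices :: "nat \<Rightarrow> (nat ^ 'd) set" where
  "multi_indices m = {i. \<forall>j. i $ j \<in> {1..m}}"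

definition jittered_cube :: "nat \<Rightarrow> nat ^ 'd \<Rightarrow> (real ^ 'd) set" where
  "jittered_cube m i = cbox (\<chi> j. (real (i $ j) - 1) / real m) (\<chi> j. real (i $ j) / real m)"

text \<open>The joint law of independent points, the \<open>i\<close>-th one uniformly distributed in the \<open>i\<close>-th
  cube. The lemmas below show that every such family of random points, on any probability space,
  has this law and the expected discrepancy \<open>expected_jittered_L2\<close>.\<close>

definition jittered_law :: "nat \<Rightarrow> (nat ^ 'd \<Rightarrow> real ^ 'd) measure" where
  "jittered_law m =
     Pi\<^sub>M (multi_indices m) (\<lambda>i. uniform_measure lborel (jittered_cube m i))"

definition expected_jittered_L2 :: "'d::finite itself \<Rightarrow> nat \<Rightarrow> real" where
  "expected_jittered_L2 _ m =
     (\<integral>p. L2_discrepancy (multi_indices m) p \<partial>(jittered_law m :: (nat ^ 'd \<Rightarrow> real ^ 'd) measure))"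

lemma bij_betw_multi_indices:
  "bij_betw vec_nth (multi_indices m :: (nat ^ 'd) set) (UNIV \<rightarrow>\<^sub>E {1..m})"
  by (rule bij_betwI[where g = vec_lambda]) (auto simp: multi_indices_def PiE_def)

lemma card_multi_indices: "card (multi_indices m :: (nat ^ 'd) set) = m ^ CARD('d)"
  using bij_betw_same_card[OF bij_betw_multi_indices[where 'd = 'd and m = m]]
  by (simp add: card_PiE)

lemma finite_multi_indices: "finite (multi_indices m :: (nat ^ 'd) set)"
  using bij_betw_finite[OF bij_betw_multi_indices[where 'd = 'd and m = m]]
  by (simp add: finite_PiE)

lemma measurable_L2_discrepancy:
  fixes I :: "'i set" and M :: "'i \<Rightarrow> (real ^ 'd) measure"
  assumes I: "finite I" and M: "\<And>i. i \<in> I \<Longrightarrow> sets (M i) = sets borel"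
  shows "L2_discrepancy I \<in> borel_measurable (Pi\<^sub>M I M)"
proof -
  have S: "sets (Pi\<^sub>M I M) = sets (Pi\<^sub>M I (\<lambda>_. borel))"
    by (rule sets_PiM_cong) (use M in auto)
  have [measurable]: "(\<lambda>x :: real ^ 'd. x $ j) \<in> borel_measurable borel" for j
    by (intro borel_measurable_continuous_onI continuous_intros)
  have "{z \<in> space (borel \<Otimes>\<^sub>M lborel :: ((real ^ 'd) \<times> (real ^ 'd)) measure).
      \<forall>j. 0 \<le> snd z $ j \<and> snd z $ j < fst z $ j} \<in> sets (borel \<Otimes>\<^sub>M lborel)"
    by measurable
  then have "{z :: (real ^ 'd) \<times> (real ^ 'd). \<forall>j. 0 \<le> snd z $ j \<and> snd z $ j < fst z $ j}
      \<in> sets (borel \<Otimes>\<^sub>M lborel)"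
    by (simp add: space_pair_measure)
  from lborel.measurable_emeasure_Pair[OF this]
  have [measurable]: "(\<lambda>x :: real ^ 'd. measure lborel (anchored_box x)) \<in> borel_measurable borel"
    unfolding anchored_box_def measure_def by (simp add: vimage_def)
  have [measurable]: "Measurable.pred (Pi\<^sub>M I (\<lambda>_. borel) \<Otimes>\<^sub>M lborel)
      (\<lambda>z. fst z k \<in> anchored_box (snd z :: real ^ 'd))" if [measurable]: "k \<in> I" for k
    unfolding anchored_box_def mem_Collect_eq by measurable
  have card: "real (card {k \<in> I. p k \<in> anchored_box x}) =
      (\<Sum>k\<in>I. if p k \<in> anchored_box x then 1 else 0)" for p and x :: "real ^ 'd"
  proof -
    have "(\<Sum>k\<in>I. if p k \<in> anchored_box x then 1 else 0) =
        (\<Sum>k\<in>{k \<in> I. p k \<in> anchored_box x}. 1::real)"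
      using I by (rule sum.inter_filter[symmetric])
    then show ?thesis by simp
  qed
  have [measurable]: "(\<lambda>z. \<Sum>k\<in>I. if fst z k \<in> anchored_box (snd z) then 1 else 0 :: real)
      \<in> borel_measurable (Pi\<^sub>M I (\<lambda>_. borel) \<Otimes>\<^sub>M (lborel :: (real ^ 'd) measure))"
    by (rule borel_measurable_sum) measurable
  have [measurable]: "cbox (0 :: real ^ 'd) 1 \<in> sets borel"
    by simp
  have "(\<lambda>p. \<integral>x. indicator (cbox 0 1) x *\<^sub>R
      \<bar>(\<Sum>k\<in>I. if p k \<in> anchored_box x then 1 else 0) / real (card I)
        - measure lborel (anchored_box x)\<bar>\<^sup>2 \<partial>lborel)
      \<in> borel_measurable (Pi\<^sub>M I (\<lambda>_. borel :: (real ^ 'd) measure))"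
    by (rule lborel.borel_measurable_lebesgue_integral) (simp add: case_prod_beta')
  then have "L2_discrepancy I \<in> borel_measurable (Pi\<^sub>M I (\<lambda>_. borel :: (real ^ 'd) measure))"
    unfolding L2_discrepancy_def set_lebesgue_integral_def card
    by (rule measurable_compose[OF _ borel_measurable_sqrt])
  then show ?thesis
    by (simp add: measurable_cong_sets[OF S refl])
qed

lemma (in prob_space) distr_eq_jittered_law:
  fixes X :: "nat ^ 'd \<Rightarrow> 'a \<Rightarrow> real ^ 'd"
  assumes m: "m \<ge> 1"
    and indep: "indep_vars (\<lambda>_. borel) X (multi_indices m)"
    and unif: "\<And>i. i \<in> multi_indices m \<Longrightarrow>
      distr M borel (X i) = uniform_measure lborel (jittered_cube m i)"
  shows "distr M (Pi\<^sub>M (multi_indices m) (\<lambda>_. borel)) (\<lambda>\<omega>. \<lambda>i\<in>multi_indices m. X i \<omega>)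
    = jittered_law m"
proof -
  have ne: "(multi_indices m :: (nat ^ 'd) set) \<noteq> {}"
    using m card_multi_indices[where 'd = 'd and m = m] by force
  have rv: "random_variable borel (X i)" if "i \<in> multi_indices m" for i
    using indep that by (simp add: indep_vars_def)
  show ?thesis
    using indep_vars_iff_distr_eq_PiM'[OF ne rv, of "\<lambda>i. i"] indep
    by (simp add: jittered_law_def unif cong: PiM_cong)
qed

lemma (in prob_space) expectation_L2_discrepancy_eq:
  fixes X :: "nat ^ 'd \<Rightarrow> 'a \<Rightarrow> real ^ 'd"
  assumes m: "m \<ge> 1"
    and indep: "indep_vars (\<lambda>_. borel) X (multi_indices m)"
    and unif: "\<And>i. i \<in> multi_indices m \<Longrightarrow>
      distr M borel (X i) = uniform_measure lborel (jittered_cube m i)"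
  shows "expectation (\<lambda>\<omega>. L2_discrepancy (multi_indices m) (\<lambda>i. X i \<omega>))
    = expected_jittered_L2 TYPE('d) m"
proof -
  have rv: "random_variable borel (X i)" if "i \<in> multi_indices m" for i
    using indep that by (simp add: indep_vars_def)
  have [simp]: "L2_discrepancy (multi_indices m) (\<lambda>i\<in>multi_indices m. p i)
      = L2_discrepancy (multi_indices m) p" for p :: "nat ^ 'd \<Rightarrow> real ^ 'd"
    by (simp add: L2_discrepancy_def cong: conj_cong)
  have law: "(jittered_law m :: (nat ^ 'd \<Rightarrow> real ^ 'd) measure) =
      distr M (Pi\<^sub>M (multi_indices m) (\<lambda>_. borel)) (\<lambda>\<omega>. \<lambda>i\<in>multi_indices m. X i \<omega>)"
    by (rule distr_eq_jittered_law[OF m indep unif, symmetric])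
  have meas: "(\<lambda>\<omega>. \<lambda>i\<in>multi_indices m. X i \<omega>)
      \<in> measurable M (Pi\<^sub>M (multi_indices m) (\<lambda>_. borel))"
    by (rule measurable_restrict) (rule rv)
  show ?thesis
    unfolding expected_jittered_L2_def law
    by (subst integral_distr[OF meas measurable_L2_discrepancy[OF finite_multi_indices refl]])
      simp
qed

end

theory Submission
  imports Defs
begin

text \<open>Write \<open>N = m\<^sup>d\<close>. For a corner \<open>x\<close>, \<open>N\<close> times the local discrepancy at \<open>x\<close> is a sum \<open>S\<close> of
  independent centred Bernoulli variables, one per cube: the indicator that the point of the cube
  lies in \<open>[0,x)\<close>, minus the fraction \<open>c\<close> of the cube that \<open>[0,x)\<close> covers. Its mean vanishes because
  the covered fractions add up to \<open>N\<close> times the volume of \<open>[0,x)\<close> (\<open>sum_covered_fraction\<close>), and its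
  variance is \<open>V(x) = \<Sum> c (1 - c)\<close>.

  Only cubes cut by the boundary of \<open>[0,x)\<close> contribute to \<open>V(x)\<close>, and these lie in \<open>d\<close> layers of
  \<open>m\<^bsup>d-1\<^esup>\<close> cubes. Hence \<open>V(x) \<le> d m\<^bsup>d-1\<^esup>\<close> (\<open>covered_variance_le\<close>), and this order is attained
  on average over \<open>x\<close> (\<open>integral_covered_variance_ge\<close>). The typical size of \<open>S\<close> is therefore
  \<open>m\<^bsup>(d-1)/2\<^esup>\<close>, and division by \<open>N\<close> gives \<open>m\<^bsup>-(d+1)/2\<^esup>\<close>.

  The upper bound for the expected discrepancy follows from the Cauchy-Schwarz inequality and
  Fubini's theorem, as the mean square of \<open>S / N\<close> is the integral of \<open>V / N\<^sup>2\<close>. For the lower bound,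
  \<open>L\<^sub>2\<close> is at least the \<open>L\<^sub>1\<close> norm of \<open>S / N\<close>, so that it suffices to bound the expectation of \<open>\<bar>S\<bar>\<close>
  from below. A second moment alone would not exclude that \<open>S\<close> is usually tiny and rarely huge; the
  fourth moment, which by independence is at most \<open>3 V\<^sup>2 + V\<close>, does
  (\<open>expectation_abs_sum_indep_ge\<close>).\<close>

section \<open>Moments of sums of independent bounded variables\<close>

lemma (in prob_space) expectation_abs_le_sqrt:
  fixes X :: "'a \<Rightarrow> real"
  assumes "integrable M X" "integrable M (\<lambda>\<omega>. (X \<omega>)\<^sup>2)"
  shows "expectation (\<lambda>\<omega>. \<bar>X \<omega>\<bar>) \<le> sqrt (expectation (\<lambda>\<omega>. (X \<omega>)\<^sup>2))"
proof -
  have "0 \<le> variance (\<lambda>\<omega>. \<bar>X \<omega>\<bar>)"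
    by (rule variance_positive)
  also have "\<dots> = expectation (\<lambda>\<omega>. (X \<omega>)\<^sup>2) - (expectation (\<lambda>\<omega>. \<bar>X \<omega>\<bar>))\<^sup>2"
    using assms by (subst variance_eq) auto
  finally show ?thesis
    by (intro real_le_rsqrt) simp
qed

text \<open>When the power of a sum of independent centred variables is expanded, every term in which some
  variable occurs to the first power has mean zero. For the square this leaves the variances; for the
  fourth power it leaves products of two variances, six times for each pair of indices, and fourth
  moments, which are at most the variances because the variables are bounded by one. Adding one
  variable at a time keeps the expansion down to two independent summands.\<close>

lemma (in prob_space)
  fixes X :: "'i \<Rightarrow> 'a \<Rightarrow> real"
  assumes fin: "finite I" and indep: "indep_vars (\<lambda>_. borel) X I"
    and mean: "\<And>i. i \<in> I \<Longrightarrow> expectation (X i) = 0"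
    and bound: "\<And>i \<omega>. i \<in> I \<Longrightarrow> \<bar>X i \<omega>\<bar> \<le> 1"
  shows second_moment_sum_indep:
      "expectation (\<lambda>\<omega>. (\<Sum>i\<in>I. X i \<omega>)\<^sup>2) = (\<Sum>i\<in>I. expectation (\<lambda>\<omega>. (X i \<omega>)\<^sup>2))"
    and fourth_moment_sum_indep_le:
      "expectation (\<lambda>\<omega>. (\<Sum>i\<in>I. X i \<omega>) ^ 4)
        \<le> 3 * (\<Sum>i\<in>I. expectation (\<lambda>\<omega>. (X i \<omega>)\<^sup>2))\<^sup>2 + (\<Sum>i\<in>I. expectation (\<lambda>\<omega>. (X i \<omega>)\<^sup>2))"
proof -
  have "expectation (\<lambda>\<omega>. (\<Sum>i\<in>I. X i \<omega>)\<^sup>2) = (\<Sum>i\<in>I. expectation (\<lambda>\<omega>. (X i \<omega>)\<^sup>2)) \<and>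
      expectation (\<lambda>\<omega>. (\<Sum>i\<in>I. X i \<omega>) ^ 4)
        \<le> 3 * (\<Sum>i\<in>I. expectation (\<lambda>\<omega>. (X i \<omega>)\<^sup>2))\<^sup>2 + (\<Sum>i\<in>I. expectation (\<lambda>\<omega>. (X i \<omega>)\<^sup>2))"
    using fin indep mean bound
  proof (induction I)
    case empty
    then show ?case by simp
  next
    case (insert i I)
    define Y where "Y = X i"
    define S where "S = (\<lambda>\<omega>. \<Sum>k\<in>I. X k \<omega>)"
    define v where "v = expectation (\<lambda>\<omega>. (Y \<omega>)\<^sup>2)"
    define V where "V = (\<Sum>k\<in>I. expectation (\<lambda>\<omega>. (X k \<omega>)\<^sup>2))"
    have "indep_vars (\<lambda>_. borel) X I"
      using insert.prems(1) by (rule indep_vars_subset) auto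
    then have IH: "expectation (\<lambda>\<omega>. (S \<omega>)\<^sup>2) = V" "expectation (\<lambda>\<omega>. S \<omega> ^ 4) \<le> 3 * V\<^sup>2 + V"
      using insert unfolding S_def V_def by auto
    have ind: "indep_var borel Y borel S"
      unfolding Y_def S_def using insert by (intro indep_vars_sum) auto
    have [measurable]: "Y \<in> borel_measurable M" "S \<in> borel_measurable M"
      using ind by (auto simp: indep_var_eq)
    have Yb: "\<bar>Y \<omega>\<bar> \<le> 1" for \<omega>
      using insert.prems(3) by (auto simp: Y_def)
    have Sb: "\<bar>S \<omega>\<bar> \<le> real (card I)" for \<omega>
      unfolding S_def using insert.prems(3)
      by (intro order.trans[OF sum_abs] sum_bounded_above[of I, where K = "1::real", simplified]) auto
    have Ypow: "\<bar>Y \<omega> ^ a\<bar> \<le> 1" for \<omega> a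
      using Yb by (simp add: power_abs power_le_one)
    have Spow: "\<bar>S \<omega> ^ b\<bar> \<le> real (card I) ^ b" for \<omega> b
      using Sb[of \<omega>] by (simp add: power_abs power_mono)
    have intY: "integrable M (\<lambda>\<omega>. Y \<omega> ^ a)" for a
      by (rule integrable_const_bound[where B = 1]) (use Ypow in auto)
    have intS: "integrable M (\<lambda>\<omega>. S \<omega> ^ b)" for b
      by (rule integrable_const_bound[where B = "real (card I) ^ b"]) (use Spow in auto)
    have prod: "indep_var borel (\<lambda>\<omega>. Y \<omega> ^ a) borel (\<lambda>\<omega>. S \<omega> ^ b)" for a b
      using indep_var_compose[OF ind, of "\<lambda>y. y ^ a" borel "\<lambda>s. s ^ b" borel] by (simp add: comp_def)
    have int: "integrable M (\<lambda>\<omega>. Y \<omega> ^ a * S \<omega> ^ b)" for a b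
      by (rule indep_var_integrable[OF prod intY intS])
    have E: "expectation (\<lambda>\<omega>. Y \<omega> ^ a * S \<omega> ^ b) =
        expectation (\<lambda>\<omega>. Y \<omega> ^ a) * expectation (\<lambda>\<omega>. S \<omega> ^ b)" for a b
      by (rule indep_var_lebesgue_integral[OF prod intY intS])
    have Y1: "expectation Y = 0"
      using insert.prems(2) by (simp add: Y_def)
    have S1: "expectation S = 0"
      unfolding S_def using insert
      by (subst Bochner_Integration.integral_sum)
        (auto intro!: integrable_const_bound[where B = 1] simp: indep_vars_def)
    \<comment> \<open>The exponents 1 are kept so that the rule \<open>E\<close> for mixed moments applies to these terms.\<close>
    have "expectation (\<lambda>\<omega>. (Y \<omega> + S \<omega>)\<^sup>2) =
        expectation (\<lambda>\<omega>. Y \<omega> ^ 2 + 2 * (Y \<omega> ^ 1 * S \<omega> ^ 1) + S \<omega> ^ 2)"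
      by (simp add: power2_sum algebra_simps)
    also have "\<dots> = v + V"
      using int[of 1 1] intY[of 2] intS[of 2] E[of 1 1] Y1 IH by (simp add: v_def)
    finally have second: "expectation (\<lambda>\<omega>. (Y \<omega> + S \<omega>)\<^sup>2) = v + V" .
    have "expectation (\<lambda>\<omega>. (Y \<omega> + S \<omega>) ^ 4) =
        expectation (\<lambda>\<omega>. Y \<omega> ^ 4 + 4 * (Y \<omega> ^ 3 * S \<omega> ^ 1) + 6 * (Y \<omega> ^ 2 * S \<omega> ^ 2)
          + 4 * (Y \<omega> ^ 1 * S \<omega> ^ 3) + S \<omega> ^ 4)"
      by (simp add: power4_eq_xxxx power3_eq_cube power2_eq_square algebra_simps)
    also have "\<dots> = expectation (\<lambda>\<omega>. Y \<omega> ^ 4) + 6 * (v * V) + expectation (\<lambda>\<omega>. S \<omega> ^ 4)"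
      using int[of 3 1] int[of 2 2] int[of 1 3] intY[of 4] intS[of 4] E[of 3 1] E[of 1 3] E[of 2 2]
        Y1 S1 IH(1) by (simp add: v_def)
    also have "\<dots> \<le> v + 6 * (v * V) + (3 * V\<^sup>2 + V)"
    proof -
      have "Y \<omega> ^ 4 \<le> (Y \<omega>)\<^sup>2" for \<omega>
      proof -
        have "(Y \<omega>)\<^sup>2 * (Y \<omega>)\<^sup>2 \<le> (Y \<omega>)\<^sup>2 * 1"
          using Ypow[of \<omega> 2] by (intro mult_left_mono) auto
        then show ?thesis by (simp add: power4_eq_xxxx power2_eq_square)
      qed
      then have "expectation (\<lambda>\<omega>. Y \<omega> ^ 4) \<le> v"
        unfolding v_def by (intro integral_mono intY)
      then show ?thesis using IH(2) by linarith
    qed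
    also have "\<dots> \<le> 3 * (v + V)\<^sup>2 + (v + V)"
      by (simp add: power2_sum algebra_simps)
    finally have "expectation (\<lambda>\<omega>. (Y \<omega> + S \<omega>) ^ 4) \<le> 3 * (v + V)\<^sup>2 + (v + V)" .
    with second show ?case
      using insert.hyps by (simp add: Y_def S_def v_def V_def)
  qed
  then show "expectation (\<lambda>\<omega>. (\<Sum>i\<in>I. X i \<omega>)\<^sup>2) = (\<Sum>i\<in>I. expectation (\<lambda>\<omega>. (X i \<omega>)\<^sup>2))"
    "expectation (\<lambda>\<omega>. (\<Sum>i\<in>I. X i \<omega>) ^ 4)
        \<le> 3 * (\<Sum>i\<in>I. expectation (\<lambda>\<omega>. (X i \<omega>)\<^sup>2))\<^sup>2 + (\<Sum>i\<in>I. expectation (\<lambda>\<omega>. (X i \<omega>)\<^sup>2))"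
    by auto
qed

text \<open>A polynomial minorant of the absolute value: its expectation depends only on the second and the
  fourth moment. The scale \<open>l\<close> is to be chosen of the order of the standard deviation.\<close>

lemma quartic_lower_bound_abs:
  fixes s l :: real
  assumes "l > 0"
  shows "s\<^sup>2 / l - s ^ 4 / (4 * l ^ 3) \<le> \<bar>s\<bar>"
proof -
  define t where "t = \<bar>s\<bar> / l"
  have t: "t \<ge> 0" "\<bar>s\<bar> = l * t"
    using assms by (auto simp: t_def)
  have *: "t\<^sup>2 - t ^ 4 / 4 \<le> t"
  proof (cases "t \<le> 2")
    case True
    \<comment> \<open>This product is \<open>4 t - 4 t\<^sup>2 + t\<^sup>4\<close>.\<close>
    then have "0 \<le> t * (t * (t - 1)\<^sup>2 + 2 * (t - 1)\<^sup>2 + (2 - t))"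
      using t by (intro mult_nonneg_nonneg add_nonneg_nonneg) auto
    then show ?thesis
      by (simp add: power2_eq_square power4_eq_xxxx algebra_simps)
  next
    case False
    then have "t\<^sup>2 * (4 - t\<^sup>2) \<le> 0"
      using power_mono[of 2 t 2] by (intro mult_nonneg_nonpos) auto
    then have "4 * t\<^sup>2 \<le> t ^ 4"
      by (simp add: power2_eq_square power4_eq_xxxx algebra_simps)
    then show ?thesis using t by linarith
  qed
  have "s\<^sup>2 = l\<^sup>2 * t\<^sup>2" "s ^ 4 = l ^ 4 * t ^ 4"
    using t by (metis power2_abs power_mult_distrib, metis power_even_abs_numeral power_mult_distrib even_numeral)
  then have "s\<^sup>2 / l - s ^ 4 / (4 * l ^ 3) = l * (t\<^sup>2 - t ^ 4 / 4)"
    using assms by (simp add: field_simps power2_eq_square power3_eq_cube power4_eq_xxxx)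
  also have "\<dots> \<le> \<bar>s\<bar>"
    using * assms t by simp
  finally show ?thesis .
qed

text \<open>The expectation of the quartic minorant at scale \<open>l\<close> is at least
  \<open>V / l - (3 V\<^sup>2 + V) / (4 l\<^sup>3)\<close>. For \<open>V \<le> B\<close> and \<open>1 \<le> B\<close> the numerator \<open>3 V\<^sup>2 + V\<close> is at most
  \<open>4 B V\<close>, and with \<open>l\<^sup>2 = 2 B\<close> the correction eats up half of the main term \<open>V / l\<close>. The bound is
  linear in \<open>V\<close> while the scale depends on \<open>B\<close> only; it can therefore be integrated over a family of
  sums with a common \<open>B\<close>.\<close>

lemma (in prob_space) expectation_abs_sum_indep_ge:
  fixes X :: "'i \<Rightarrow> 'a \<Rightarrow> real"
  assumes fin: "finite I" and indep: "indep_vars (\<lambda>_. borel) X I"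
    and mean: "\<And>i. i \<in> I \<Longrightarrow> expectation (X i) = 0"
    and bound: "\<And>i \<omega>. i \<in> I \<Longrightarrow> \<bar>X i \<omega>\<bar> \<le> 1"
    and B: "(\<Sum>i\<in>I. expectation (\<lambda>\<omega>. (X i \<omega>)\<^sup>2)) \<le> B" "1 \<le> B"
  shows "(\<Sum>i\<in>I. expectation (\<lambda>\<omega>. (X i \<omega>)\<^sup>2)) / (2 * sqrt (2 * B))
    \<le> expectation (\<lambda>\<omega>. \<bar>\<Sum>i\<in>I. X i \<omega>\<bar>)"
proof -
  define S where "S = (\<lambda>\<omega>. \<Sum>i\<in>I. X i \<omega>)"
  define V where "V = (\<Sum>i\<in>I. expectation (\<lambda>\<omega>. (X i \<omega>)\<^sup>2))"
  define l where "l = sqrt (2 * B)"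
  have l: "l > 0" "l\<^sup>2 = 2 * B"
    using B by (auto simp: l_def)
  have V: "0 \<le> V"
    unfolding V_def by (intro sum_nonneg) simp
  have [measurable]: "S \<in> borel_measurable M"
    unfolding S_def using indep by (intro borel_measurable_sum) (auto simp: indep_vars_def)
  have "\<bar>S \<omega>\<bar> \<le> real (card I)" for \<omega>
    unfolding S_def using bound
    by (intro order.trans[OF sum_abs] sum_bounded_above[of I, where K = "1::real", simplified]) auto
  then have "\<bar>S \<omega> ^ b\<bar> \<le> real (card I) ^ b" for \<omega> b
    by (simp add: power_abs power_mono)
  then have int: "integrable M (\<lambda>\<omega>. S \<omega> ^ b)" for b
    by (intro integrable_const_bound[where B = "real (card I) ^ b"]) auto
  have "3 * V\<^sup>2 + V = V * (3 * V + 1)"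
    by (simp add: power2_eq_square algebra_simps)
  also have "\<dots> \<le> V * (4 * B)"
    using B V by (intro mult_left_mono) (auto simp: V_def)
  finally have "(3 * V\<^sup>2 + V) / (4 * l ^ 3) \<le> V * (4 * B) / (4 * l ^ 3)"
    using l by (intro divide_right_mono) auto
  also have "\<dots> = V / (2 * l)"
  proof -
    have "4 * l ^ 3 = 8 * B * l"
      using l by (simp add: power3_eq_cube power2_eq_square)
    then show ?thesis using l B by (simp add: field_simps)
  qed
  finally have "V / (2 * l) \<le> V / l - (3 * V\<^sup>2 + V) / (4 * l ^ 3)"
    by (simp add: field_simps)
  also have "\<dots> \<le> expectation (\<lambda>\<omega>. (S \<omega>)\<^sup>2) / l - expectation (\<lambda>\<omega>. S \<omega> ^ 4) / (4 * l ^ 3)"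
    using second_moment_sum_indep[OF fin indep mean bound]
      fourth_moment_sum_indep_le[OF fin indep mean bound] l
    by (intro diff_mono divide_right_mono) (auto simp: S_def V_def)
  also have "\<dots> = expectation (\<lambda>\<omega>. (S \<omega>)\<^sup>2 / l - S \<omega> ^ 4 / (4 * l ^ 3))"
    using int by simp
  also have "\<dots> \<le> expectation (\<lambda>\<omega>. \<bar>S \<omega>\<bar>)"
    using int[of 1] int l
    by (intro integral_mono quartic_lower_bound_abs) auto
  finally show ?thesis
    unfolding V_def l_def S_def .
qed

section \<open>The part of a cube covered by an anchored box\<close>

text \<open>The fraction of the interval from \<open>(k - 1) / m\<close> to \<open>k / m\<close> below \<open>t\<close>. As a difference of
  consecutive values of one function of \<open>k\<close> it telescopes.\<close>

definition slice_fraction :: "nat \<Rightarrow> nat \<Rightarrow> real \<Rightarrow> real" where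
  "slice_fraction m k t = real m * (min t (real k / real m) - min t ((real k - 1) / real m))"

definition covered_fraction :: "nat \<Rightarrow> nat ^ 'd \<Rightarrow> real ^ 'd::finite \<Rightarrow> real" where
  "covered_fraction m i x = (\<Prod>j\<in>UNIV. slice_fraction m (i $ j) (x $ j))"

lemma slice_fraction_bounds:
  assumes "m > 0"
  shows "0 \<le> slice_fraction m k t" "slice_fraction m k t \<le> 1"
  using assms by (auto simp: slice_fraction_def min_def field_simps)

lemma covered_fraction_bounds:
  assumes "m > 0"
  shows "0 \<le> covered_fraction m i x" "covered_fraction m i x \<le> 1"
  unfolding covered_fraction_def
  using slice_fraction_bounds[OF assms] by (auto intro: prod_nonneg prod_le_1)

text \<open>Of the \<open>m\<close> intervals, only the one that contains \<open>t\<close> can be cut properly.\<close>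

lemma slice_fraction_cases:
  assumes "m > 0"
  shows "slice_fraction m k t \<in> {0, 1} \<or> k = nat \<lceil>real m * t\<rceil>"
proof (cases "real k - 1 < real m * t \<and> real m * t < real k")
  case True
  then have "\<lceil>real m * t\<rceil> = int k"
    by (intro ceiling_unique) auto
  then show ?thesis by simp
next
  case False
  then show ?thesis
    using assms by (auto simp: slice_fraction_def min_def field_simps)
qed

lemma sum_slice_fraction:
  assumes "m > 0" "0 \<le> t" "t \<le> 1"
  shows "(\<Sum>k = 1..m. slice_fraction m k t) = real m * t"
proof -
  have "(\<Sum>k = 1..m. slice_fraction m k t) =
      real m * (\<Sum>k = 1..m. min t (real k / real m) - min t (real (k - 1) / real m))"
    unfolding sum_distrib_left
    by (intro sum.cong) (auto simp: slice_fraction_def of_nat_diff)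
  also have "(\<Sum>k = 1..m. min t (real k / real m) - min t (real (k - 1) / real m)) = t"
    using sum_telescope''[of 0 m "\<lambda>k. min t (real k / real m)"] assms
    by (simp add: atLeastSucAtMost_greaterThanAtMost)
  finally show ?thesis .
qed

text \<open>The distributive law for indices that are vectors: it reduces sums over cubes to one coordinate.\<close>

lemma sum_prod_vec:
  fixes f :: "'d::finite \<Rightarrow> 'b \<Rightarrow> 'c::comm_semiring_1"
  assumes "\<And>j. finite (A j)"
  shows "(\<Sum>i\<in>{i. \<forall>j. i $ j \<in> A j}. \<Prod>j\<in>UNIV. f j (i $ j)) = (\<Prod>j\<in>UNIV. \<Sum>k\<in>A j. f j k)"
proof -
  have "bij_betw vec_nth {i. \<forall>j. i $ j \<in> A j} (PiE UNIV A)"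
    by (rule bij_betwI[where g = vec_lambda]) (auto simp: PiE_def)
  then show ?thesis
    using assms by (subst prod_sum_PiE) (auto simp: sum.reindex_bij_betw
      [where g = "\<lambda>g. \<Prod>j\<in>UNIV. f j (g j)", symmetric])
qed

lemma card_vec_box:
  fixes A :: "'d::finite \<Rightarrow> 'b set"
  assumes "\<And>j. finite (A j)"
  shows "card {i. \<forall>j. i $ j \<in> A j} = (\<Prod>j\<in>UNIV. card (A j))"
  using sum_prod_vec[OF assms, of "\<lambda>_ _. 1::nat"] by simp

text \<open>The intersection of a closed box with an anchored box is half-open in some coordinates. Unless it
  is empty, it lies between an open box and a closed box with the same corners, so its volume is theirs.\<close>

lemma
  fixes a b x :: "real ^ 'd::finite"
  assumes ab: "\<And>j. a $ j \<le> b $ j"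
  shows sets_clipped_box: "{y. \<forall>j. a $ j \<le> y $ j \<and> y $ j \<le> b $ j \<and> y $ j < x $ j} \<in> sets borel"
    and measure_clipped_box:
    "measure lborel {y. \<forall>j. a $ j \<le> y $ j \<and> y $ j \<le> b $ j \<and> y $ j < x $ j}
      = (\<Prod>j\<in>UNIV. min (x $ j) (b $ j) - min (x $ j) (a $ j))"
proof -
  define A where "A = {y. \<forall>j. a $ j \<le> y $ j \<and> y $ j \<le> b $ j \<and> y $ j < x $ j}"
  have [measurable]: "(\<lambda>y :: real ^ 'd. y $ j) \<in> borel_measurable borel" for j
    by (intro borel_measurable_continuous_onI continuous_intros)
  have "{y \<in> space borel. \<forall>j. a $ j \<le> y $ j \<and> y $ j \<le> b $ j \<and> y $ j < x $ j} \<in> sets borel"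
    by measurable
  then have A: "A \<in> sets borel"
    by (simp add: A_def)
  then show "{y. \<forall>j. a $ j \<le> y $ j \<and> y $ j \<le> b $ j \<and> y $ j < x $ j} \<in> sets borel"
    by (simp add: A_def)
  have "measure lborel A = (\<Prod>j\<in>UNIV. min (x $ j) (b $ j) - min (x $ j) (a $ j))"
  proof (cases "\<forall>j. a $ j < x $ j")
    case False
    then obtain j where j: "x $ j \<le> a $ j" by (auto simp: not_less)
    then have "A = {}"
      unfolding A_def by (auto intro!: exI[of _ j])
    moreover have "(\<Prod>j\<in>UNIV. min (x $ j) (b $ j) - min (x $ j) (a $ j)) = 0"
      using j ab[of j] by (intro prod_zero) (auto simp: min_def intro!: exI[of _ j])
    ultimately show ?thesis by simp
  next
    case True
    define c where "c = (\<chi> j. min (x $ j) (b $ j))"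
    have c: "a $ j \<le> c $ j" for j
      using True ab by (auto simp: c_def less_imp_le)
    then have ne: "cbox a c \<noteq> {}"
      by (simp add: interval_ne_empty_cart)
    have cl: "measure lborel (cbox a c) = (\<Prod>j\<in>UNIV. c $ j - a $ j)"
      using content_cbox_cart[OF ne] by simp
    have op: "measure lborel (box a c) = measure lborel (cbox a c)"
      using ne by (simp add: measure_lborel_box_eq measure_lborel_cbox_eq)
    have "y $ j \<le> c $ j" if "y \<in> A" for y j
      using that by (auto simp: A_def c_def intro: less_imp_le)
    moreover have "a $ j \<le> y $ j" if "y \<in> A" for y j
      using that by (simp add: A_def)
    ultimately have sub1: "A \<subseteq> cbox a c"
      by (simp add: mem_box_cart subset_iff)
    have sub2: "box a c \<subseteq> A"
    proof
      fix y assume "y \<in> box a c"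
      then have "a $ j < y $ j" "y $ j < c $ j" for j
        by (simp_all add: mem_box_cart)
      then show "y \<in> A"
        by (simp add: A_def c_def less_imp_le)
    qed
    have fm: "A \<in> fmeasurable lborel"
      by (rule fmeasurableI2[OF fmeasurable_cbox sub1]) (simp add: A)
    have "measure lborel A = measure lborel (cbox a c)"
    proof (rule antisym)
      show "measure lborel A \<le> measure lborel (cbox a c)"
        by (rule measure_mono_fmeasurable[OF sub1]) (simp_all add: A)
      show "measure lborel (cbox a c) \<le> measure lborel A"
        unfolding op[symmetric] by (rule measure_mono_fmeasurable[OF sub2 _ fm]) simp
    qed
    also have "\<dots> = (\<Prod>j\<in>UNIV. min (x $ j) (b $ j) - min (x $ j) (a $ j))"
      unfolding cl using True by (simp add: c_def min_absorb2 less_imp_le)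
    finally show ?thesis .
  qed
  then show "measure lborel {y. \<forall>j. a $ j \<le> y $ j \<and> y $ j \<le> b $ j \<and> y $ j < x $ j}
      = (\<Prod>j\<in>UNIV. min (x $ j) (b $ j) - min (x $ j) (a $ j))"
    by (simp add: A_def)
qed

lemma measure_anchored_box:
  fixes x :: "real ^ 'd::finite"
  assumes "\<And>j. 0 \<le> x $ j"
  shows "measure lborel (anchored_box x) = (\<Prod>j\<in>UNIV. x $ j)"
proof -
  have "anchored_box x = {y. \<forall>j. 0 $ j \<le> y $ j \<and> y $ j \<le> x $ j \<and> y $ j < x $ j}"
    by (auto simp: anchored_box_def less_imp_le)
  then show ?thesis
    using measure_clipped_box[of 0 x x] assms by (simp add: min_absorb2)
qed

lemma sets_anchored_box: "anchored_box (x :: real ^ 'd::finite) \<in> sets borel"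
proof -
  have "anchored_box x = {y. \<forall>j. 0 $ j \<le> y $ j \<and> y $ j \<le> max 0 (x $ j) \<and> y $ j < x $ j}"
    by (auto simp: anchored_box_def le_max_iff_disj less_imp_le)
  then show ?thesis
    using sets_clipped_box[of 0 "\<chi> j. max 0 (x $ j)" x] by simp
qed

lemma
  fixes i :: "nat ^ 'd::finite"
  assumes m: "m > 0"
  shows measure_jittered_cube: "measure lborel (jittered_cube m i) = (1 / real m) ^ CARD('d)"
    and prob_space_uniform_jittered_cube: "prob_space (uniform_measure lborel (jittered_cube m i))"
proof -
  have ne: "jittered_cube m i \<noteq> {}"
    using m by (simp add: jittered_cube_def interval_ne_empty_cart divide_right_mono)
  then show *: "measure lborel (jittered_cube m i) = (1 / real m) ^ CARD('d)"
    using content_cbox_cart[OF ne[unfolded jittered_cube_def]]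
    by (simp add: jittered_cube_def diff_divide_distrib)
  have "emeasure lborel (jittered_cube m i) \<noteq> \<infinity>"
    unfolding jittered_cube_def by (metis emeasure_lborel_cbox_finite less_irrefl)
  moreover have "emeasure lborel (jittered_cube m i) \<noteq> 0"
    using * m by (auto simp: measure_def)
  ultimately show "prob_space (uniform_measure lborel (jittered_cube m i))"
    by (intro prob_space_uniform_measure) auto
qed

lemma measure_uniform_jittered_cube_anchored_box:
  fixes i :: "nat ^ 'd::finite"
  assumes m: "m > 0" and i: "i \<in> multi_indices m"
  shows "measure (uniform_measure lborel (jittered_cube m i)) (anchored_box x) = covered_fraction m i x"
proof -
  define a b :: "real ^ 'd" where
    "a = (\<chi> j. (real (i $ j) - 1) / real m)" and "b = (\<chi> j. real (i $ j) / real m)"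
  have a0: "0 \<le> a $ j" for j
  proof -
    have "1 \<le> i $ j"
      using i by (auto simp: multi_indices_def)
    then show ?thesis
      using m by (simp add: a_def)
  qed
  have "0 \<le> y $ j" if "a $ j \<le> y $ j" for y j
    using a0[of j] that by linarith
  then have eq: "jittered_cube m i \<inter> anchored_box x
      = {y. \<forall>j. a $ j \<le> y $ j \<and> y $ j \<le> b $ j \<and> y $ j < x $ j}"
    unfolding jittered_cube_def anchored_box_def a_def[symmetric] b_def[symmetric] mem_box_cart
    by (auto simp: mem_box_cart)
  have vol: "measure lborel (jittered_cube m i \<inter> anchored_box x)
      = (\<Prod>j\<in>UNIV. min (x $ j) (b $ j) - min (x $ j) (a $ j))"
    unfolding eq by (rule measure_clipped_box) (simp add: a_def b_def divide_right_mono)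
  have cov: "covered_fraction m i x =
      real m ^ CARD('d) * (\<Prod>j\<in>UNIV. min (x $ j) (b $ j) - min (x $ j) (a $ j))"
    by (simp add: covered_fraction_def slice_fraction_def prod.distrib a_def b_def)
  have "measure (uniform_measure lborel (jittered_cube m i)) (anchored_box x)
      = measure lborel (jittered_cube m i \<inter> anchored_box x) / measure lborel (jittered_cube m i)"
  proof (rule measure_uniform_measure)
    show "emeasure lborel (jittered_cube m i) \<noteq> 0"
      using measure_jittered_cube[OF m, of i] m by (auto simp: measure_def)
    show "emeasure lborel (jittered_cube m i) \<noteq> \<infinity>"
      unfolding jittered_cube_def by (metis emeasure_lborel_cbox_finite less_irrefl)
  qed (simp add: sets_anchored_box)
  also have "\<dots> = covered_fraction m i x"
    unfolding vol cov measure_jittered_cube[OF m] by (simp add: power_divide mult.commute)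
  finally show ?thesis .
qed

text \<open>The cubes tile the unit cube. Instead of using that they overlap in null sets only, the sum over
  the cubes is factored into one telescoping sum for each coordinate.\<close>

lemma sum_covered_fraction:
  fixes x :: "real ^ 'd::finite"
  assumes m: "m > 0" and x: "x \<in> cbox 0 1"
  shows "(\<Sum>i\<in>multi_indices m. covered_fraction m i x)
    = real (m ^ CARD('d)) * measure lborel (anchored_box x)"
proof -
  have x': "0 \<le> x $ j" "x $ j \<le> 1" for j
    using x by (auto simp: mem_box_cart)
  have "(\<Sum>i\<in>multi_indices m. covered_fraction m i x) = (\<Prod>j\<in>UNIV. \<Sum>k = 1..m. slice_fraction m k (x $ j))"
    unfolding multi_indices_def covered_fraction_def
    using sum_prod_vec[of "\<lambda>_. {1..m}" "\<lambda>j k. slice_fraction m k (x $ j)"] by simp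
  also have "\<dots> = (\<Prod>j\<in>UNIV. real m * x $ j)"
    using m x' by (intro prod.cong sum_slice_fraction) auto
  finally show ?thesis
    using x' by (simp add: prod.distrib measure_anchored_box)
qed

section \<open>The variance of the counting function\<close>

text \<open>The variance of the number of points in the box anchored at \<open>x\<close>: the point of the cube \<open>i\<close> lies in
  this box with probability \<open>covered_fraction m i x\<close>.\<close>

definition covered_variance :: "nat \<Rightarrow> real ^ 'd::finite \<Rightarrow> real" where
  "covered_variance m x =
    (\<Sum>i\<in>multi_indices m. covered_fraction m i x * (1 - covered_fraction m i x))"

text \<open>A cube contributes at most one, and nothing unless \<open>x\<close> cuts it properly in some coordinate \<open>j\<close>. Then
  the index \<open>i $ j\<close> is determined by \<open>x\<close>, which leaves \<open>m\<^bsup>d-1\<^esup>\<close> choices for the others.\<close>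

lemma covered_variance_le:
  fixes x :: "real ^ 'd::finite"
  assumes m: "m > 0"
  shows "covered_variance m x \<le> real CARD('d) * real m ^ (CARD('d) - 1)"
proof -
  define q where "q j = nat \<lceil>real m * x $ j\<rceil>" for j
  have "covered_fraction m i x * (1 - covered_fraction m i x) \<le> (\<Sum>j\<in>UNIV. of_bool (i $ j = q j))"
    for i
  proof (cases "\<exists>j. i $ j = q j")
    case True
    then obtain j where "i $ j = q j" ..
    then have "1 \<le> (\<Sum>j\<in>UNIV. of_bool (i $ j = q j) :: real)"
      using member_le_sum[of j UNIV "\<lambda>j. of_bool (i $ j = q j) :: real"] by simp
    moreover have "covered_fraction m i x * (1 - covered_fraction m i x) \<le> 1 * 1"
      using covered_fraction_bounds[OF m, of i x] by (intro mult_mono) auto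
    ultimately show ?thesis by linarith
  next
    case False
    then have "slice_fraction m (i $ j) (x $ j) \<in> {0, 1}" for j
      using slice_fraction_cases[OF m, of "i $ j" "x $ j"] by (auto simp: q_def)
    then have "covered_fraction m i x \<in> {0, 1}"
      unfolding covered_fraction_def by (cases "\<exists>j. slice_fraction m (i $ j) (x $ j) = 0") auto
    then show ?thesis by (auto simp: sum_nonneg)
  qed
  then have "covered_variance m x
      \<le> (\<Sum>i\<in>multi_indices m. \<Sum>j\<in>UNIV. of_bool (i $ j = q j))"
    unfolding covered_variance_def by (rule sum_mono)
  also have "\<dots> = (\<Sum>j\<in>UNIV. real (card {i \<in> multi_indices m. i $ j = q j}))"
    by (subst sum.swap) (simp add: finite_multi_indices Collect_conj_eq)
  also have "\<dots> \<le> (\<Sum>j\<in>(UNIV :: 'd set). real m ^ (CARD('d) - 1))"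
  proof (rule sum_mono)
    fix j :: 'd
    define A where "A l = (if l = j then {1..m} \<inter> {q j} else {1..m})" for l
    have "{i \<in> multi_indices m. i $ j = q j} = {i. \<forall>l. i $ l \<in> A l}"
    proof (intro set_eqI iffI; clarsimp)
      fix i :: "nat ^ 'd" and l assume i: "i \<in> multi_indices m" "i $ j = q j"
      from i(1) have "i $ l \<in> {1..m}"
        unfolding multi_indices_def by blast
      with i(2) show "i $ l \<in> A l"
        by (cases "l = j") (auto simp: A_def)
    next
      fix i :: "nat ^ 'd" assume i: "\<forall>l. i $ l \<in> A l"
      have "i $ l \<in> {1..m}" for l
        using i[rule_format, of l] by (auto simp: A_def split: if_splits)
      moreover have "i $ j = q j"
        using i[rule_format, of j] by (simp add: A_def)
      ultimately show "i \<in> multi_indices m \<and> i $ j = q j"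
        by (simp add: multi_indices_def)
    qed
    then have "card {i \<in> multi_indices m. i $ j = q j} = (\<Prod>l\<in>UNIV. card (A l))"
      using card_vec_box[of A] by (simp add: A_def)
    also have "\<dots> = card (A j) * (\<Prod>l\<in>UNIV - {j}. card (A l))"
      by (simp add: prod.remove[of _ j])
    also have "\<dots> \<le> 1 * (\<Prod>l\<in>UNIV - {j}. m)"
    proof (intro mult_mono prod_mono)
      show "card (A j) \<le> 1"
        using card_mono[of "{q j}" "A j"] by (simp add: A_def)
    qed (auto simp: A_def)
    finally show "real (card {i \<in> multi_indices m. i $ j = q j}) \<le> real m ^ (CARD('d) - 1)"
      by (simp flip: of_nat_power)
  qed
  finally show ?thesis by simp
qed

lemma borel_measurable_vec_nth [measurable]:
  "(\<lambda>x :: real ^ 'd::finite. x $ j) \<in> borel_measurable borel"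
  by (intro borel_measurable_continuous_onI continuous_intros)

lemma borel_measurable_covered_fraction [measurable]:
  "covered_fraction m i \<in> borel_measurable (borel :: (real ^ 'd::finite) measure)"
  unfolding covered_fraction_def slice_fraction_def by measurable

abbreviation unit_cube :: "(real ^ 'd::finite) measure" where
  "unit_cube \<equiv> restrict_space lborel (cbox 0 1)"

lemma prob_space_unit_cube: "prob_space (unit_cube :: (real ^ 'd::finite) measure)"
proof (rule prob_space_restrict_space)
  have "emeasure lborel (cbox (0 :: real ^ 'd) 1) \<noteq> \<infinity>"
    by (metis emeasure_lborel_cbox_finite less_irrefl)
  moreover have "measure lborel (cbox (0 :: real ^ 'd) 1) = 1"
    using content_cbox_cart[of "0 :: real ^ 'd" 1] by (simp add: interval_ne_empty_cart)
  ultimately show "emeasure lborel (cbox (0 :: real ^ 'd) 1) = 1"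
    by (simp add: emeasure_eq_ennreal_measure)
qed simp

lemma cube_variance_bounds:
  assumes "m > 0"
  shows "0 \<le> covered_fraction m i x * (1 - covered_fraction m i x)"
    and "covered_fraction m i x * (1 - covered_fraction m i x) \<le> 1"
  using covered_fraction_bounds[OF assms, of i x] by (auto intro: mult_le_one)

lemma integrable_cube_variance:
  assumes "m > 0"
  shows "integrable unit_cube (\<lambda>x. covered_fraction m i x * (1 - covered_fraction m i x))"
proof -
  interpret U: prob_space "unit_cube :: (real ^ 'b) measure"
    by (rule prob_space_unit_cube)
  have "norm (covered_fraction m i x * (1 - covered_fraction m i x)) \<le> 1" for x
    unfolding real_norm_def using cube_variance_bounds[OF assms, of i x] by linarith
  then show ?thesis
    by (intro U.integrable_const_bound[where B = 1] measurable_restrict_space1) auto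
qed

lemma slice_fraction_eq:
  assumes "m > 0"
  shows "slice_fraction m k t = min (real m * t) (real k) - min (real m * t) (real k - 1)"
  using assms by (auto simp: slice_fraction_def min_def field_simps)

lemma div_2_bounds:
  assumes "m \<ge> 2"
  shows "real m / 3 \<le> real (m div 2)" "2 * real (m div 2) \<le> real m"
proof -
  have "m \<le> 3 * (m div 2)" using assms by presburger
  then show "real m / 3 \<le> real (m div 2)" by linarith
  have "2 * (m div 2) \<le> m" by simp
  then show "2 * real (m div 2) \<le> real m" by linarith
qed

text \<open>If the corner \<open>x\<close> lies in the middle half of the slab of the cube in direction \<open>j\<^sub>0\<close> and beyond the cube
  in all other directions, then between a quarter and three quarters of the cube are covered, and the
  cube contributes at least \<open>3 / 16\<close> to the variance. For a cube in the lower half in the other directions,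
  these corners fill at least a box of volume \<open>1 / (2 m) * (1 / 2)\<^bsup>d-1\<^esup>\<close>.\<close>

lemma integral_cube_variance_ge:
  fixes i :: "nat ^ 'd::finite" and j\<^sub>0 :: 'd
  assumes m: "m > 0" and i0: "i $ j\<^sub>0 \<in> {1..m}"
    and i: "\<And>j. j \<noteq> j\<^sub>0 \<Longrightarrow> 2 * real (i $ j) \<le> real m"
  shows "3 / (32 * real m) * (1 / 2) ^ (CARD('d) - 1)
    \<le> (\<integral>x. covered_fraction m i x * (1 - covered_fraction m i x) \<partial>unit_cube)"
proof -
  interpret U: prob_space "unit_cube :: (real ^ 'd) measure"
    by (rule prob_space_unit_cube)
  define k where "k = real (i $ j\<^sub>0)"
  define a b :: "real ^ 'd" where
    "a = (\<chi> j. if j = j\<^sub>0 then (k - 3 / 4) / real m else 1 / 2)" and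
    "b = (\<chi> j. if j = j\<^sub>0 then (k - 1 / 4) / real m else 1)"
  have k: "1 \<le> k" "k \<le> real m"
    using i0 by (auto simp: k_def)
  have ab: "0 \<le> a $ j" "a $ j \<le> b $ j" "b $ j \<le> 1" for j
    using m k by (auto simp: a_def b_def field_simps)
  have sub: "cbox a b \<subseteq> cbox 0 1"
  proof
    fix x assume x: "x \<in> cbox a b"
    have "0 \<le> x $ j" "x $ j \<le> 1" for j
    proof -
      have "a $ j \<le> x $ j" "x $ j \<le> b $ j"
        using x by (simp_all add: mem_box_cart)
      with ab[of j] show "0 \<le> x $ j" "x $ j \<le> 1"
        by linarith+
    qed
    then show "x \<in> cbox 0 1"
      by (simp add: mem_box_cart)
  qed
  have ne: "cbox a b \<noteq> {}"
    using ab by (simp add: interval_ne_empty_cart)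
  have cov: "covered_fraction m i x \<in> {1/4..3/4}" if x: "x \<in> cbox a b" for x
  proof -
    have x': "a $ j \<le> x $ j" "x $ j \<le> b $ j" for j
      using x by (auto simp: mem_box_cart)
    have "slice_fraction m (i $ j) (x $ j) = 1" if "j \<noteq> j\<^sub>0" for j
    proof -
      have "real (i $ j) / real m \<le> 1 / 2"
        using i[OF that] m by (simp add: field_simps)
      also have "1 / 2 \<le> x $ j"
        using x'(1)[of j] that by (simp add: a_def)
      finally show ?thesis
        using m by (simp add: slice_fraction_def min_def field_simps)
    qed
    then have "covered_fraction m i x = slice_fraction m (i $ j\<^sub>0) (x $ j\<^sub>0)"
      unfolding covered_fraction_def by (simp add: prod.remove[of _ j\<^sub>0])
    also have "\<dots> \<in> {1/4..3/4}"
    proof -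
      have "k - 3 / 4 \<le> real m * x $ j\<^sub>0" "real m * x $ j\<^sub>0 \<le> k - 1 / 4"
        using x'[of j\<^sub>0] m by (auto simp: a_def b_def field_simps)
      then show ?thesis
        unfolding slice_fraction_eq[OF m] k_def[symmetric] by (auto simp: min_def)
    qed
    finally show ?thesis .
  qed
  have low: "3 / 16 * indicator (cbox a b) x \<le> covered_fraction m i x * (1 - covered_fraction m i x)" for x
  proof (cases "x \<in> cbox a b")
    case True
    \<comment> \<open>This expands to \<open>c (1 - c) \<ge> 3 / 16\<close>.\<close>
    have "0 \<le> (covered_fraction m i x - 1 / 4) * (3 / 4 - covered_fraction m i x)"
      using cov[OF True] by (intro mult_nonneg_nonneg) auto
    then show ?thesis
      using True by (simp add: algebra_simps)
  next
    case False
    then show ?thesis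
      using covered_fraction_bounds[OF m, of i x] by simp
  qed
  have "(\<Prod>j\<in>UNIV. b $ j - a $ j) = 1 / (2 * real m) * (1 / 2) ^ (CARD('d) - 1)"
    using m by (simp add: prod.remove[of _ j\<^sub>0] a_def b_def field_simps)
  then have "3 / (32 * real m) * (1 / 2) ^ (CARD('d) - 1) = 3 / 16 * measure lborel (cbox a b)"
    using content_cbox_cart[OF ne] by simp
  also have "measure lborel (cbox a b) = measure unit_cube (cbox a b)"
    using sub by (simp add: measure_restrict_space)
  also have "3 / 16 * \<dots> = (\<integral>x. 3 / 16 * indicator (cbox a b) x \<partial>unit_cube)"
    using sub by (simp add: space_restrict_space Int_absorb2 Int_absorb1)
  also have "\<dots> \<le> (\<integral>x. covered_fraction m i x * (1 - covered_fraction m i x) \<partial>unit_cube)"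
  proof (rule integral_mono[OF _ _ low])
    have [measurable]: "cbox a b \<in> sets unit_cube"
      using sub by (simp add: sets_restrict_space_iff)
    show "integrable unit_cube (\<lambda>x. 3 / 16 * indicator (cbox a b) x :: real)"
      by (intro U.integrable_const_bound[where B = 1]) (auto simp: indicator_def)
    show "integrable unit_cube (\<lambda>x. covered_fraction m i x * (1 - covered_fraction m i x))"
      using m by (rule integrable_cube_variance)
  qed
  finally show ?thesis .
qed

text \<open>There are \<open>m\<close> times \<open>(m div 2)\<^bsup>d-1\<^esup>\<close> cubes to which the previous bound applies, and
  \<open>m div 2 \<ge> m / 3\<close> if \<open>m \<ge> 2\<close>. For \<open>m = 1\<close> and \<open>d > 1\<close> there would be none.\<close>

lemma integral_covered_variance_ge:
  assumes m: "m \<ge> 2"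
  shows "3 / 32 * (1 / 6) ^ (CARD('d) - 1) * real m ^ (CARD('d) - 1)
    \<le> (\<integral>x. covered_variance m x \<partial>(unit_cube :: (real ^ 'd::finite) measure))"
proof -
  interpret U: prob_space "unit_cube :: (real ^ 'd) measure"
    by (rule prob_space_unit_cube)
  let ?v = "\<lambda>i x :: real ^ 'd. covered_fraction m i x * (1 - covered_fraction m i x)"
  \<comment> \<open>Any coordinate direction will do.\<close>
  obtain j\<^sub>0 :: 'd where True by simp
  define A where "A j = (if j = j\<^sub>0 then {1..m} else {1..m div 2})" for j
  define J :: "(nat ^ 'd) set" where "J = {i. \<forall>j. i $ j \<in> A j}"
  have J: "J \<subseteq> multi_indices m"
    by (force simp: J_def A_def multi_indices_def split: if_splits)
  have "card J = (\<Prod>j\<in>UNIV. card (A j))"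
    unfolding J_def by (rule card_vec_box) (simp add: A_def)
  also have "\<dots> = m * (m div 2) ^ (CARD('d) - 1)"
    by (simp add: prod.remove[of _ j\<^sub>0] A_def)
  finally have cardJ: "real (card J) = real m * real (m div 2) ^ (CARD('d) - 1)"
    by simp
  have int: "integrable unit_cube (?v i)" for i
    using m by (intro integrable_cube_variance) simp
  have nonneg: "0 \<le> ?v i x" for i x
    using m by (intro cube_variance_bounds) simp
  have "3 / 32 * (1 / 6) ^ (CARD('d) - 1) * real m ^ (CARD('d) - 1)
      = 3 / 32 * (1 / 2) ^ (CARD('d) - 1) * (real m / 3) ^ (CARD('d) - 1)"
    by (simp add: power_divide flip: power_mult_distrib)
  also have "\<dots> \<le> 3 / 32 * (1 / 2) ^ (CARD('d) - 1) * real (m div 2) ^ (CARD('d) - 1)"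
    using div_2_bounds[OF m] by (intro mult_left_mono power_mono) auto
  also have "\<dots> = (\<Sum>i\<in>J. 3 / (32 * real m) * (1 / 2) ^ (CARD('d) - 1))"
    using m by (simp add: cardJ field_simps)
  also have "\<dots> \<le> (\<Sum>i\<in>J. \<integral>x. ?v i x \<partial>unit_cube)"
  proof (intro sum_mono integral_cube_variance_ge)
    fix i j assume "i \<in> J"
    then have i: "i $ l \<in> A l" for l by (simp add: J_def)
    show "i $ j\<^sub>0 \<in> {1..m}"
      using i[of j\<^sub>0] by (simp add: A_def)
    show "2 * real (i $ j) \<le> real m" if "j \<noteq> j\<^sub>0"
    proof -
      have "i $ j \<le> m div 2" using i[of j] that by (simp add: A_def)
      then show ?thesis using div_2_bounds(2)[OF m] by linarith
    qed
  qed (use m in simp)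
  also have "\<dots> \<le> (\<Sum>i\<in>multi_indices m. \<integral>x. ?v i x \<partial>unit_cube)"
    using J nonneg by (intro sum_mono2 finite_multi_indices integral_nonneg) auto
  also have "\<dots> = (\<integral>x. covered_variance m x \<partial>(unit_cube :: (real ^ 'd) measure))"
    unfolding covered_variance_def
    by (rule Bochner_Integration.integral_sum[symmetric]) (rule int)
  finally show ?thesis .
qed

section \<open>The deviation of the counting function\<close>

definition point_deviation :: "nat \<Rightarrow> nat ^ 'd \<Rightarrow> real ^ 'd::finite \<Rightarrow> real ^ 'd \<Rightarrow> real" where
  "point_deviation m i x y = indicator (anchored_box x) y - covered_fraction m i x"

definition count_deviation :: "nat \<Rightarrow> (nat ^ 'd \<Rightarrow> real ^ 'd::finite) \<Rightarrow> real ^ 'd \<Rightarrow> real" where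
  "count_deviation m p x = (\<Sum>i\<in>multi_indices m. point_deviation m i x (p i))"

text \<open>On the unit cube the local discrepancy is \<open>count_deviation / N\<close>, because the covered fractions sum to
  \<open>N\<close> times the volume of the anchored box.\<close>

lemma L2_discrepancy_eq:
  fixes p :: "nat ^ 'd::finite \<Rightarrow> real ^ 'd"
  assumes m: "m > 0"
  shows "L2_discrepancy (multi_indices m) p =
    sqrt (\<integral>x. (count_deviation m p x)\<^sup>2 \<partial>unit_cube) / real (m ^ CARD('d))"
proof -
  let ?I = "multi_indices m :: (nat ^ 'd) set" and ?N = "real (m ^ CARD('d))"
  have N: "?N > 0" using m by simp
  have "\<bar>real (card {k \<in> ?I. p k \<in> anchored_box x}) / real (card ?I)
         - measure lborel (anchored_box x)\<bar>\<^sup>2 = (count_deviation m p x)\<^sup>2 / ?N\<^sup>2"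
    if x: "x \<in> cbox 0 1" for x
  proof -
    have "real (card {k \<in> ?I. p k \<in> anchored_box x}) = (\<Sum>k\<in>?I. indicator (anchored_box x) (p k))"
      by (simp add: indicator_def finite_multi_indices Collect_conj_eq)
    then have "count_deviation m p x
        = real (card {k \<in> ?I. p k \<in> anchored_box x}) - ?N * measure lborel (anchored_box x)"
      using sum_covered_fraction[OF m x]
      by (simp add: count_deviation_def point_deviation_def sum_subtractf)
    then have "real (card {k \<in> ?I. p k \<in> anchored_box x}) / real (card ?I)
         - measure lborel (anchored_box x) = count_deviation m p x / ?N"
      using N by (simp add: card_multi_indices diff_divide_distrib)
    then show ?thesis
      by (simp only: power2_abs power_divide)
  qed
  then have eq: "(\<integral>x. \<bar>real (card {k \<in> ?I. p k \<in> anchored_box x}) / real (card ?I)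
         - measure lborel (anchored_box x)\<bar>\<^sup>2 \<partial>unit_cube)
      = (\<integral>x. (count_deviation m p x)\<^sup>2 / ?N\<^sup>2 \<partial>unit_cube)"
    by (intro Bochner_Integration.integral_cong refl) (simp add: space_restrict_space)
  have "(LINT x:cbox 0 1|lborel. \<bar>real (card {k \<in> ?I. p k \<in> anchored_box x}) / real (card ?I)
         - measure lborel (anchored_box x)\<bar>\<^sup>2)
      = (\<integral>x. (count_deviation m p x)\<^sup>2 / ?N\<^sup>2 \<partial>unit_cube)"
    unfolding eq[symmetric] set_lebesgue_integral_def by (subst integral_restrict_space) simp_all
  also have "\<dots> = (\<integral>x. (count_deviation m p x)\<^sup>2 \<partial>unit_cube) / ?N\<^sup>2"
    by simp
  finally show ?thesis
    using N by (simp add: L2_discrepancy_def real_sqrt_divide)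
qed

lemma abs_point_deviation_le_1:
  assumes "m > 0"
  shows "\<bar>point_deviation m i x y\<bar> \<le> 1"
  using covered_fraction_bounds[OF assms, of i x]
  by (auto simp: point_deviation_def indicator_def)

lemma abs_count_deviation_le:
  fixes p :: "nat ^ 'd::finite \<Rightarrow> real ^ 'd"
  assumes "m > 0"
  shows "\<bar>count_deviation m p x\<bar> \<le> real (m ^ CARD('d))"
  unfolding count_deviation_def card_multi_indices[symmetric]
  using abs_point_deviation_le_1[OF assms]
  by (intro order.trans[OF sum_abs] sum_bounded_above[where K = "1::real", simplified]) auto

lemma borel_measurable_point_deviation [measurable]:
  "point_deviation m i x \<in> borel_measurable borel"
  unfolding point_deviation_def using sets_anchored_box[of x] by measurable

context
  fixes m :: nat
  assumes m: "m > 0"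
begin

lemma prob_space_jittered_law:
  "prob_space (jittered_law m :: (nat ^ 'd::finite \<Rightarrow> real ^ 'd) measure)"
  unfolding jittered_law_def using prob_space_uniform_jittered_cube[OF m] by (intro prob_space_PiM)

lemma distr_jittered_law:
  fixes i :: "nat ^ 'd::finite"
  assumes "i \<in> multi_indices m"
  shows "distr (jittered_law m) borel (\<lambda>p. p i) = uniform_measure lborel (jittered_cube m i)"
proof -
  have "distr (jittered_law m) borel (\<lambda>p. p i)
      = distr (jittered_law m) (uniform_measure lborel (jittered_cube m i)) (\<lambda>p. p i)"
    by (rule distr_cong) auto
  then show ?thesis
    unfolding jittered_law_def
    using distr_PiM_component[OF prob_space_uniform_jittered_cube[OF m] assms] by simp
qed

lemma sets_jittered_law [measurable_cong]:
  "sets (jittered_law m :: (nat ^ 'd::finite \<Rightarrow> real ^ 'd) measure) = sets (Pi\<^sub>M (multi_indices m) (\<lambda>_. borel))"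
  unfolding jittered_law_def by (rule sets_PiM_cong) auto

text \<open>The coordinate functions on a product of probability spaces are independent.\<close>

lemma indep_vars_jittered_law:
  "prob_space.indep_vars (jittered_law m :: (nat ^ 'd::finite \<Rightarrow> real ^ 'd) measure)
    (\<lambda>_. borel) (\<lambda>i p. p i) (multi_indices m)"
proof -
  let ?I = "multi_indices m :: (nat ^ 'd) set"
  let ?P = "jittered_law m :: (nat ^ 'd \<Rightarrow> real ^ 'd) measure"
  interpret prob_space ?P
    by (rule prob_space_jittered_law)
  have "card ?I > 0"
    using m by (simp add: card_multi_indices)
  then have ne: "?I \<noteq> {}" by auto
  have rv: "random_variable borel (\<lambda>p. p i)" if "i \<in> ?I" for i
    using that by measurable
  have "space ?P = ?I \<rightarrow>\<^sub>E UNIV"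
    by (simp add: jittered_law_def space_PiM)
  then have "distr ?P (Pi\<^sub>M ?I (\<lambda>_. borel)) (\<lambda>p. \<lambda>i\<in>?I. p i) = distr ?P ?P (\<lambda>p. p)"
    by (intro distr_cong) (auto simp: sets_jittered_law PiE_restrict restrict_def PiE_def extensional_def fun_eq_iff)
  also have "\<dots> = ?P"
    by (rule distr_id)
  also have "\<dots> = Pi\<^sub>M ?I (\<lambda>i. distr ?P borel (\<lambda>p. p i))"
    by (subst jittered_law_def) (auto simp: distr_jittered_law intro!: PiM_cong)
  finally show ?thesis
    using indep_vars_iff_distr_eq_PiM'[OF ne rv] by simp
qed

lemma indep_vars_point_deviation:
  "prob_space.indep_vars (jittered_law m :: (nat ^ 'd::finite \<Rightarrow> real ^ 'd) measure)
    (\<lambda>_. borel) (\<lambda>i p. point_deviation m i x (p i)) (multi_indices m)"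
  by (rule prob_space.indep_vars_compose2[OF prob_space_jittered_law indep_vars_jittered_law])
    measurable

lemma
  fixes i :: "nat ^ 'd::finite"
  assumes i: "i \<in> multi_indices m"
  shows expectation_point_deviation: "(\<integral>p. point_deviation m i x (p i) \<partial>jittered_law m) = 0"
    and variance_point_deviation:
      "(\<integral>p. (point_deviation m i x (p i))\<^sup>2 \<partial>jittered_law m) = covered_fraction m i x * (1 - covered_fraction m i x)"
proof -
  let ?M = "uniform_measure lborel (jittered_cube m i)" and ?c = "covered_fraction m i x"
  interpret M: prob_space ?M
    by (rule prob_space_uniform_jittered_cube[OF m])
  have [measurable]: "anchored_box x \<in> sets borel"
    by (rule sets_anchored_box)
  have ind: "integrable ?M (indicator (anchored_box x) :: _ \<Rightarrow> real)"
    by (rule M.integrable_const_bound[where B = 1]) auto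
  have E: "(\<integral>y. indicator (anchored_box x) y \<partial>?M) = ?c"
    using measure_uniform_jittered_cube_anchored_box[OF m i] by simp
  have tr: "(\<integral>p. f (p i) \<partial>jittered_law m) = (\<integral>y. f y \<partial>?M)" if "f \<in> borel_measurable borel" for f :: "_ \<Rightarrow> real"
  proof -
    have "(\<lambda>p. p i) \<in> borel_measurable (jittered_law m)"
      using i by measurable
    then show ?thesis
      unfolding distr_jittered_law[OF i, symmetric] by (subst integral_distr[OF _ that]) simp_all
  qed
  have "(\<integral>p. point_deviation m i x (p i) \<partial>jittered_law m) = (\<integral>y. indicator (anchored_box x) y - ?c \<partial>?M)"
    using tr[OF borel_measurable_point_deviation] by (simp add: point_deviation_def)
  also have "\<dots> = 0"
    using ind E M.prob_space by simp
  finally show "(\<integral>p. point_deviation m i x (p i) \<partial>jittered_law m) = 0" .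
  have "(\<integral>p. (point_deviation m i x (p i))\<^sup>2 \<partial>jittered_law m)
      = (\<integral>y. (1 - 2 * ?c) * indicator (anchored_box x) y + ?c\<^sup>2 \<partial>?M)"
    by (subst tr[of "\<lambda>y. (point_deviation m i x y)\<^sup>2"])
      (auto simp: point_deviation_def power2_eq_square algebra_simps indicator_def
        intro!: Bochner_Integration.integral_cong)
  also have "\<dots> = (1 - 2 * ?c) * ?c + ?c\<^sup>2"
    using ind E M.prob_space by simp
  also have "\<dots> = ?c * (1 - ?c)"
    by (simp add: power2_eq_square algebra_simps)
  finally show "(\<integral>p. (point_deviation m i x (p i))\<^sup>2 \<partial>jittered_law m) = ?c * (1 - ?c)" .
qed

lemma second_moment_count_deviation:
  fixes x :: "real ^ 'd::finite"
  shows "(\<integral>p. (count_deviation m p x)\<^sup>2 \<partial>jittered_law m) = covered_variance m x"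
  unfolding count_deviation_def covered_variance_def
  by (subst prob_space.second_moment_sum_indep[OF prob_space_jittered_law finite_multi_indices
        indep_vars_point_deviation expectation_point_deviation abs_point_deviation_le_1[OF m]])
    (simp_all add: variance_point_deviation)

text \<open>The bound for absolute first moments is used with the uniform upper bound of the variance as \<open>B\<close>, so
  that the denominator does not depend on \<open>x\<close>.\<close>

lemma first_moment_count_deviation_ge:
  fixes x :: "real ^ 'd::finite"
  shows "covered_variance m x / (2 * sqrt (2 * (real CARD('d) * real m ^ (CARD('d) - 1))))
    \<le> (\<integral>p. \<bar>count_deviation m p x\<bar> \<partial>jittered_law m)"
proof -
  have "1 * 1 \<le> real CARD('d) * real m ^ (CARD('d) - 1)"
    using m by (intro mult_mono one_le_power) (auto simp: Suc_le_eq)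
  then show ?thesis
    using prob_space.expectation_abs_sum_indep_ge[OF prob_space_jittered_law finite_multi_indices
        indep_vars_point_deviation expectation_point_deviation abs_point_deviation_le_1[OF m],
        of x "real CARD('d) * real m ^ (CARD('d) - 1)"]
      covered_variance_le[OF m, of x]
    by (simp add: count_deviation_def covered_variance_def variance_point_deviation)
qed

lemma borel_measurable_count_deviation:
  "(\<lambda>z :: (nat ^ 'd::finite \<Rightarrow> real ^ 'd) \<times> (real ^ 'd). count_deviation m (fst z) (snd z))
    \<in> borel_measurable (jittered_law m \<Otimes>\<^sub>M unit_cube)"
proof -
  have [measurable]: "(\<lambda>x. x) \<in> unit_cube \<rightarrow>\<^sub>M (borel :: (real ^ 'd) measure)"
    by (rule measurable_restrict_space1) simp
  then have [measurable]: "snd \<in> jittered_law m \<Otimes>\<^sub>M unit_cube \<rightarrow>\<^sub>M (borel :: (real ^ 'd) measure)"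
    by (rule measurable_compose[OF measurable_snd])
  have "(\<lambda>z. (if \<forall>j. 0 \<le> fst z i $ j \<and> fst z i $ j < snd z $ j then 1 else 0)
      - covered_fraction m i (snd z)) \<in> borel_measurable (jittered_law m \<Otimes>\<^sub>M unit_cube)"
    if [measurable]: "i \<in> multi_indices m" for i :: "nat ^ 'd"
    by measurable
  then show ?thesis
    unfolding count_deviation_def point_deviation_def
    by (intro borel_measurable_sum) (simp add: anchored_box_def indicator_def of_bool_def)
qed

end

section \<open>Two-sided bounds for the expected discrepancy\<close>

lemma integral_covered_variance_le:
  assumes m: "m > 0"
  shows "(\<integral>x. covered_variance m x \<partial>(unit_cube :: (real ^ 'd::finite) measure))
    \<le> real CARD('d) * real m ^ (CARD('d) - 1)"
proof -
  interpret U: prob_space "unit_cube :: (real ^ 'd) measure"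
    by (rule prob_space_unit_cube)
  have "integrable unit_cube (covered_variance m :: real ^ 'd \<Rightarrow> real)"
    unfolding covered_variance_def
    by (intro Bochner_Integration.integrable_sum integrable_cube_variance m)
  then show ?thesis
    using covered_variance_le[OF m]
    by (intro U.integral_le_const) auto
qed

text \<open>Both bounds exchange the integrals over point sets and over corners. Above, the expected \<open>L\<^sub>2\<close> norm is at
  most the root of its second moment, which is the integral of the variance. Below, the \<open>L\<^sub>2\<close> norm is
  at least the \<open>L\<^sub>1\<close> norm, and the expectation of the latter is an integral of absolute first moments.\<close>

lemma expected_L2_bounds:
  assumes m: "m > 0"
  defines "N \<equiv> real (m ^ CARD('d::finite))" and "B \<equiv> real CARD('d) * real m ^ (CARD('d) - 1)"
  shows expected_L2_le: "expected_jittered_L2 TYPE('d) m \<le> sqrt B / N"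
    and expected_L2_ge: "(\<integral>x. covered_variance m x \<partial>(unit_cube :: (real ^ 'd) measure))
      / (2 * sqrt (2 * B)) / N \<le> expected_jittered_L2 TYPE('d) m"
proof -
  let ?P = "jittered_law m :: (nat ^ 'd \<Rightarrow> real ^ 'd) measure"
  let ?U = "unit_cube :: (real ^ 'd) measure"
  let ?L = "L2_discrepancy (multi_indices m) :: (nat ^ 'd \<Rightarrow> real ^ 'd) \<Rightarrow> real"
  interpret P: prob_space ?P
    by (rule prob_space_jittered_law[OF m])
  interpret U: prob_space ?U
    by (rule prob_space_unit_cube)
  interpret PU: pair_prob_space ?P ?U ..
  note [measurable] = borel_measurable_count_deviation[OF m, where 'd = 'd]
  have N: "N > 0"
    using m by (simp add: N_def)
  have bound: "\<bar>count_deviation m p x\<bar> \<le> N" for p :: "nat ^ 'd \<Rightarrow> real ^ 'd" and x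
    unfolding N_def by (rule abs_count_deviation_le[OF m])
  have sq: "(count_deviation m p x)\<^sup>2 \<le> N\<^sup>2" for p :: "nat ^ 'd \<Rightarrow> real ^ 'd" and x
    using power_mono[OF bound[of p x], of 2] by simp
  have int1: "integrable (?P \<Otimes>\<^sub>M ?U) (\<lambda>(p, x). \<bar>count_deviation m p x\<bar>)"
    by (rule PU.integrable_const_bound[where B = N]) (use bound in \<open>auto simp: case_prod_beta\<close>)
  have int2: "integrable (?P \<Otimes>\<^sub>M ?U) (\<lambda>(p, x). (count_deviation m p x)\<^sup>2)"
    by (rule PU.integrable_const_bound[where B = "N\<^sup>2"]) (use sq in \<open>auto simp: case_prod_beta\<close>)
  have meas: "count_deviation m p \<in> borel_measurable ?U" if "p \<in> space ?P" for p
    using measurable_compose[OF measurable_Pair1'[OF that] borel_measurable_count_deviation[OF m]]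
    by simp
  have intU1: "integrable ?U (count_deviation m p)" if "p \<in> space ?P" for p
    using bound by (intro U.integrable_const_bound[where B = N] meas that) auto
  have intU2: "integrable ?U (\<lambda>x. (count_deviation m p x)\<^sup>2)" if "p \<in> space ?P" for p
    using sq meas[OF that] by (intro U.integrable_const_bound[where B = "N\<^sup>2"]) auto
  have L: "?L p = sqrt (\<integral>x. (count_deviation m p x)\<^sup>2 \<partial>?U) / N" for p
    unfolding N_def by (rule L2_discrepancy_eq[OF m])
  have L0: "0 \<le> ?L p" for p
    using N by (simp add: L)
  have L1: "?L p \<le> 1" if "p \<in> space ?P" for p
  proof -
    have "(\<integral>x. (count_deviation m p x)\<^sup>2 \<partial>?U) \<le> N\<^sup>2"
      using sq by (intro U.integral_le_const intU2 that) auto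
    then have "sqrt (\<integral>x. (count_deviation m p x)\<^sup>2 \<partial>?U) \<le> N"
      using N by (intro real_le_lsqrt) auto
    then show ?thesis
      using N by (simp add: L)
  qed
  have [measurable]: "?L \<in> borel_measurable ?P"
    unfolding jittered_law_def by (rule measurable_L2_discrepancy) (auto simp: finite_multi_indices)
  have intL: "integrable ?P ?L"
    using L0 L1 by (intro P.integrable_const_bound[where B = 1]) auto
  have intL2: "integrable ?P (\<lambda>p. (?L p)\<^sup>2)"
    using L0 L1 by (intro P.integrable_const_bound[where B = 1]) (auto intro!: AE_I2 power_le_one)
  have E: "expected_jittered_L2 TYPE('d) m = (\<integral>p. ?L p \<partial>?P)"
    by (simp add: expected_jittered_L2_def)

  have "(\<integral>p. (?L p)\<^sup>2 \<partial>?P) = (\<integral>p. (\<integral>x. (count_deviation m p x)\<^sup>2 \<partial>?U) \<partial>?P) / N\<^sup>2"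
    unfolding L power_divide by (simp add: integral_nonneg)
  also have "(\<integral>p. (\<integral>x. (count_deviation m p x)\<^sup>2 \<partial>?U) \<partial>?P)
      = (\<integral>x. (\<integral>p. (count_deviation m p x)\<^sup>2 \<partial>?P) \<partial>?U)"
    using PU.Fubini_integral[OF int2] by simp
  also have "\<dots> = (\<integral>x. covered_variance m x \<partial>?U)"
    by (simp add: second_moment_count_deviation[OF m])
  also have "\<dots> / N\<^sup>2 \<le> B / N\<^sup>2"
    unfolding B_def by (intro divide_right_mono integral_covered_variance_le m) simp
  finally have second: "(\<integral>p. (?L p)\<^sup>2 \<partial>?P) \<le> B / N\<^sup>2" .
  have "expected_jittered_L2 TYPE('d) m = (\<integral>p. \<bar>?L p\<bar> \<partial>?P)"
    unfolding E using L0 by simp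
  also have "\<dots> \<le> sqrt (\<integral>p. (?L p)\<^sup>2 \<partial>?P)"
    by (rule P.expectation_abs_le_sqrt[OF intL intL2])
  also have "\<dots> \<le> sqrt (B / N\<^sup>2)"
    using second by (rule real_sqrt_le_mono)
  also have "\<dots> = sqrt B / N"
    using N by (simp add: real_sqrt_divide)
  finally show "expected_jittered_L2 TYPE('d) m \<le> sqrt B / N" .

  have int1P: "integrable ?P (\<lambda>p. \<integral>x. \<bar>count_deviation m p x\<bar> \<partial>?U)"
    using PU.integrable_fst[OF int1] by simp
  have int1U: "integrable ?U (\<lambda>x. \<integral>p. \<bar>count_deviation m p x\<bar> \<partial>?P)"
    using PU.integrable_snd[OF int1] by simp
  have "(\<integral>x. covered_variance m x \<partial>?U) / (2 * sqrt (2 * B))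
      = (\<integral>x. covered_variance m x / (2 * sqrt (2 * B)) \<partial>?U)"
    by simp
  also have "\<dots> \<le> (\<integral>x. (\<integral>p. \<bar>count_deviation m p x\<bar> \<partial>?P) \<partial>?U)"
  proof (rule integral_mono[OF _ int1U])
    show "integrable ?U (\<lambda>x. covered_variance m x / (2 * sqrt (2 * B)))"
      unfolding covered_variance_def
      by (intro integrable_divide Bochner_Integration.integrable_sum integrable_cube_variance m)
    show "covered_variance m x / (2 * sqrt (2 * B)) \<le> (\<integral>p. \<bar>count_deviation m p x\<bar> \<partial>?P)" for x
      unfolding B_def by (rule first_moment_count_deviation_ge[OF m])
  qed
  also have "\<dots> = (\<integral>p. (\<integral>x. \<bar>count_deviation m p x\<bar> \<partial>?U) \<partial>?P)"
    using PU.Fubini_integral[OF int1] by simp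
  finally have "(\<integral>x. covered_variance m x \<partial>?U) / (2 * sqrt (2 * B)) / N
      \<le> (\<integral>p. (\<integral>x. \<bar>count_deviation m p x\<bar> \<partial>?U) \<partial>?P) / N"
    by (rule divide_right_mono) (use N in simp)
  also have "\<dots> = (\<integral>p. (\<integral>x. \<bar>count_deviation m p x\<bar> \<partial>?U) / N \<partial>?P)"
    by simp
  also have "\<dots> \<le> (\<integral>p. ?L p \<partial>?P)"
  proof (intro integral_mono integrable_divide int1P intL)
    show "(\<integral>x. \<bar>count_deviation m p x\<bar> \<partial>?U) / N \<le> ?L p" if "p \<in> space ?P" for p
      unfolding L using N intU1[OF that] intU2[OF that]
      by (intro divide_right_mono U.expectation_abs_le_sqrt) auto
  qed
  finally show "(\<integral>x. covered_variance m x \<partial>?U) / (2 * sqrt (2 * B)) / N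
      \<le> expected_jittered_L2 TYPE('d) m"
    by (simp add: E)
qed

lemma sqrt_power_div_eq_powr:
  assumes "m > 0" "d \<ge> 1"
  shows "sqrt (real m ^ (d - 1)) / real (m ^ d) = real m powr (- (real d / 2 + 1 / 2))"
proof -
  have "sqrt (real m ^ (d - 1)) = real m powr ((real d - 1) / 2)"
    using assms by (simp add: powr_half_sqrt[symmetric] powr_powr of_nat_diff flip: powr_realpow)
  moreover have "real (m ^ d) = real m powr real d"
    using assms by (simp add: powr_realpow)
  ultimately have "sqrt (real m ^ (d - 1)) / real (m ^ d) = real m powr ((real d - 1) / 2 - real d)"
    by (simp only: powr_diff)
  also have "(real d - 1) / 2 - real d = - (real d / 2 + 1 / 2)"
    by (simp add: field_simps)
  finally show ?thesis .
qed

text \<open>The variance is of order \<open>m\<^bsup>d-1\<^esup>\<close> on average and at most of this order everywhere. In the lower bound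
  it is divided by the root of that order, so both bounds are of order \<open>m\<^bsup>(d-1)/2\<^esup> / m\<^bsup>d\<^esup>\<close>.\<close>

lemma expected_L2_two_sided:
  obtains c C :: real where "0 < c" "c \<le> C"
    and "\<And>m. m \<ge> 2 \<Longrightarrow> c * real m powr (- (real CARD('d::finite) / 2 + 1 / 2))
        \<le> expected_jittered_L2 TYPE('d) m"
    and "\<And>m. m \<ge> 2 \<Longrightarrow> expected_jittered_L2 TYPE('d) m
        \<le> C * real m powr (- (real CARD('d) / 2 + 1 / 2))"
proof -
  let ?d = "CARD('d)"
  define k where "k = 3 / 32 * (1 / 6 :: real) ^ (?d - 1)"
  define c where "c = k / (2 * sqrt (2 * real ?d))"
  define C where "C = sqrt (real ?d)"
  have d: "?d \<ge> 1" by (simp add: Suc_le_eq)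
  have c0: "c > 0"
    by (simp add: c_def k_def)
  have low: "c * real m powr (- (real ?d / 2 + 1 / 2)) \<le> expected_jittered_L2 TYPE('d) m"
    if m: "m \<ge> 2" for m
  proof -
    define M where "M = real m ^ (?d - 1)"
    have m0: "m > 0" and M: "M > 0" using m by (auto simp: M_def)
    have "c * real m powr (- (real ?d / 2 + 1 / 2)) = c * sqrt M / real (m ^ ?d)"
      unfolding M_def sqrt_power_div_eq_powr[OF m0 d, symmetric] by (rule times_divide_eq_right)
    also have "c * sqrt M = k * M / (2 * sqrt (2 * (real ?d * M)))"
      using M by (simp add: c_def real_sqrt_mult field_simps)
    also have "\<dots> / real (m ^ ?d)
        \<le> (\<integral>x. covered_variance m x \<partial>(unit_cube :: (real ^ 'd) measure))
          / (2 * sqrt (2 * (real ?d * M))) / real (m ^ ?d)"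
      using M integral_covered_variance_ge[OF m, where 'd = 'd]
      by (intro divide_right_mono) (auto simp: k_def M_def)
    also have "\<dots> \<le> expected_jittered_L2 TYPE('d) m"
      using expected_L2_ge[OF m0, where 'd = 'd] by (simp add: M_def)
    finally show ?thesis .
  qed
  have up: "expected_jittered_L2 TYPE('d) m \<le> C * real m powr (- (real ?d / 2 + 1 / 2))"
    if m: "m \<ge> 2" for m
  proof -
    have m0: "m > 0" using m by simp
    have "expected_jittered_L2 TYPE('d) m
        \<le> C * (sqrt (real m ^ (?d - 1)) / real (m ^ ?d))"
      using expected_L2_le[OF m0, where 'd = 'd] by (simp add: C_def real_sqrt_mult)
    then show ?thesis
      unfolding sqrt_power_div_eq_powr[OF m0 d] .
  qed
  have "c \<le> C"
  proof -
    \<comment> \<open>The lower bound cannot exceed the upper bound at \<open>m = 2\<close>, so the constants are ordered.\<close>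
    have "c * real 2 powr (- (real ?d / 2 + 1 / 2)) \<le> C * real 2 powr (- (real ?d / 2 + 1 / 2))"
      by (rule order.trans[OF low up]) simp_all
    then show ?thesis
      by (rule mult_right_le_imp_le) simp
  qed
  with c0 low up that show ?thesis by blast
qed

theorem corollary4:
  shows "(\<lambda>m. expected_jittered_L2 TYPE('d::finite) m)
           \<in> \<Theta>(\<lambda>m. 1 / real m powr (real CARD('d) / 2 + 1 / 2))
       \<and> (\<lambda>m. expected_jittered_L2 TYPE('d) m)
           \<in> \<Theta>(\<lambda>m. 1 / real (m ^ CARD('d)) powr (1 / 2 + 1 / (2 * real CARD('d))))
       \<and> (\<exists>c C :: real. 0 < c \<and> c \<le> C \<and>
            (\<forall>m \<ge> 2.
               c * real (m ^ CARD('d)) powr (- 1 / 2 - 1 / (2 * real CARD('d)))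
                 \<le> expected_jittered_L2 TYPE('d) m \<and>
               expected_jittered_L2 TYPE('d) m
                 \<le> C * real (m ^ CARD('d)) powr (- 1 / 2 - 1 / (2 * real CARD('d)))))"
proof -
  let ?E = "expected_jittered_L2 TYPE('d)"
  let ?e = "real CARD('d) / 2 + 1 / 2"
  obtain c C :: real where c: "0 < c" "c \<le> C"
    and low: "\<And>m. m \<ge> 2 \<Longrightarrow> c * real m powr (- ?e) \<le> ?E m"
    and up: "\<And>m. m \<ge> 2 \<Longrightarrow> ?E m \<le> C * real m powr (- ?e)"
    using expected_L2_two_sided[where 'd = 'd] by blast
  have N: "real (m ^ CARD('d)) powr s = real m powr (real CARD('d) * s)" for m s
    by (cases "m = 0") (simp_all add: powr_powr flip: powr_realpow)
  have e: "real CARD('d) * (1 / 2 + 1 / (2 * real CARD('d))) = ?e"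
    "real CARD('d) * (- 1 / 2 - 1 / (2 * real CARD('d))) = - ?e"
    by (simp_all add: field_simps)
  have nrm: "\<bar>1 / real m powr ?e\<bar> = real m powr (- ?e)" for m
    unfolding powr_minus_divide[symmetric] by simp
  have "eventually (\<lambda>m. c * norm (1 / real m powr ?e) \<le> norm (?E m)) sequentially"
    using eventually_ge_at_top[of 2]
    by eventually_elim (unfold real_norm_def nrm, rule order.trans[OF low abs_ge_self])
  moreover have "eventually (\<lambda>m. norm (?E m) \<le> C * norm (1 / real m powr ?e)) sequentially"
    using eventually_ge_at_top[of 2]
  proof eventually_elim
    case (elim m)
    have "0 \<le> c * real m powr (- ?e)"
      using c by simp
    with low[OF elim] up[OF elim] show ?case
      unfolding real_norm_def nrm by linarith
  qed
  ultimately have Theta: "?E \<in> \<Theta>(\<lambda>m. 1 / real m powr ?e)"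
    using c by (intro bigthetaI landau_o.bigI[of C] landau_omega.bigI[of c]) auto
  have "\<forall>m \<ge> 2. c * real (m ^ CARD('d)) powr (- 1 / 2 - 1 / (2 * real CARD('d))) \<le> ?E m \<and>
      ?E m \<le> C * real (m ^ CARD('d)) powr (- 1 / 2 - 1 / (2 * real CARD('d)))"
    unfolding N e using low up by blast
  with Theta c show ?thesis
    unfolding N e by blast
qed

end
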